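(* Let $\sigma_1,\sigma_2,\ldots\in\overline{K}_c$ with $|\sigma_1|=1$ and $|\sigma_l|\le1$ for all $l$, let $\delta_0=\sum_{l\ge1}\sigma_l\Delta^{(l)}$, $\delta=\tau^{-1}\delta_0$, and assume $S_n=\sum_{l=1}^n\sigma_l/D_{n-l}^{q^l}\neq0$ for all $n\ge1$. Let $\{P_n\}$ be the basic sequence of $\delta$ and $Q_n=P_n/D_n$. Define $e_\delta(t)=\sum_{j\ge0}b_jt^{q^j}$ by $b_0=1$, $b_{j+1}=\dfrac{b_j^q}{D_{j+1}S_{j+1}}$, and $\log_\delta(t)=\sum_{n\ge0}\beta_nt^{q^n}$ by $\beta_0=1$, $\beta_l=-\sum_{m=1}^lb_m\beta_{l-m}^{q^m}$ ($l\ge1$) (so $\log_\delta$ is the composition inverse of $e_\delta$ as formal power series). Let $D_q=\{t\in O:|t|\le q^{-1}\}$ if $q\ne2$ and $D_q=\{t\in O:|t|\le q^{-2}\}$ if $q=2$. Then both series $e_\delta$ and $\log_\delta$ converge on $D_q$, and $$e_\delta(t\log_\delta z)=\sum_{n=0}^\infty Q_n(t)z^{q^n}\qquad\text{for all }t\in O,\ z\in D_q.$$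
   Context: Let $p$ be a prime, $q=p^\nu$, $K=\mathbb F_q((x))$ the field of formal Laurent series over $\mathbb F_q$ with absolute value $|\sum_{i\ge m}\zeta_ix^i|=q^{-m}$ ($\zeta_m\ne0$), $O=\{z\in K:|z|\le1\}$, and $\overline{K}_c$ the completion of an algebraic closure of $K$. $\overline{K}_c\{t\}$ is the $\overline{K}_c$-vector space of $\mathbb F_q$-linear polynomials $\sum_k a_kt^{q^k}$ (finite sums). For $\lambda\in K$, $(\rho_\lambda u)(t)=u(\lambda t)$; an operator is invariant if it commutes with all $\rho_\lambda$. $\tau u=u^q$ (Frobenius), and on polynomials with no linear term $\tau^{-1}\sum_{k\ge1}a_kt^{q^k}=\sum_{k\ge1}a_k^{1/q}t^{q^{k-1}}$. $[i]=x^{q^i}-x$; $D_0=1$, $D_i=[i][i-1]^q\cdots[1]^{q^{i-1}}$. $(\Delta u)(t)=u(xt)-xu(t)$, $d=\tau^{-1}\Delta$, and $\Delta^{(l)}=\tau^ld^l$; explicitly $\Delta^{(l)}(t^{q^n})=\frac{D_n}{D_{n-l}^{q^l}}t^{q^n}$ for $n\ge l$ and $0$ for $n<l$. Thus $\delta_0(t)=0$ and $\delta_0(t^{q^n})=D_nS_nt^{q^n}$, so $\delta$ is a delta operator when all $S_n\ne0$. A delta operator is $\delta=\tau^{-1}\delta_0$ with $\delta_0$ linear invariant, $\delta_0(t)=0$, $\delta_0(t^{q^n})=c_nt^{q^n}$ with $c_n\neq0$ for $n\ge1$. Its basic sequence is the unique $\{P_n\}$ in $\overline{K}_c\{t\}$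 with $\deg P_n=q^n$, $P_0(1)=1$, $P_n(1)=0$ ($n\ge1$), $\delta P_0=0$, $\delta P_n=[n]^{1/q}P_{n-1}$ ($n\ge1$). The recursion for $b_j$ expresses the condition $\delta e_\delta=e_\delta$, $b_0=1$. *)

theory Defs
  imports
    "HOL-Analysis.Analysis"
    "HOL-Algebra.Algebraic_Closure_Type"
begin

text \<open>
  Throughout, \<open>'k\<close> is a finite field with \<open>q\<close> elements and \<open>'k fls\<close> is the field of
  formal Laurent series over it. The absolute value on \<open>'k fls\<close> has base \<open>q\<close>; it induces
  the topology of the library metric on Laurent series, but that metric uses base 2.
\<close>

definition fls_abs :: "'k::{field,finite} fls \<Rightarrow> real" where
  "fls_abs z = (if z = 0 then 0 else real CARD('k) powi (- fls_subdegree z))"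

definition fls_integers :: "'k::{field,finite} fls set" where
  "fls_integers = {z. fls_abs z \<le> 1}"

definition fls_disc :: "'k::{field,finite} fls set" where
  "fls_disc = {t \<in> fls_integers.
     fls_abs t \<le> (if CARD('k) = 2 then 1 / real CARD('k) ^ 2 else 1 / real CARD('k))}"

text \<open>
  The completion of an algebraic closure of \<open>'k fls\<close>: a field \<open>'c\<close> that is complete for
  a nonarchimedean absolute value \<open>av\<close>, together with an embedding of the algebraic closure
  of \<open>'k fls\<close> that has dense image and along which \<open>av\<close> extends the absolute value of
  \<open>'k fls\<close>. As the extension of the absolute value to the algebraic closure is unique,
  this determines \<open>'c\<close> up to isometric isomorphism. Completeness is the type class
  \<open>complete_space\<close>.
\<close>

locale completed_alg_closure =
  fixes iota :: "'k::{field,finite} fls alg_closure \<Rightarrow> 'c::{field,complete_space}"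
    and av :: "'c \<Rightarrow> real"
  assumes iota_one: "iota 1 = 1"
    and iota_add: "iota (a + b) = iota a + iota b"
    and iota_mult: "iota (a * b) = iota a * iota b"
    and dist_av: "dist u v = av (u - v)"
    and av_mult: "av (u * v) = av u * av v"
    and av_ultrametric: "av (u + v) \<le> max (av u) (av v)"
    and av_extends: "av (iota (to_ac z)) = fls_abs z"
    and dense_range: "closure (range iota) = UNIV"

text \<open>
  Below, \<open>x\<close> stands for the image of the Laurent series variable in \<open>'c\<close>.
\<close>

definition brk :: "nat \<Rightarrow> 'c::field \<Rightarrow> nat \<Rightarrow> 'c" where
  "brk q x i = x ^ (q ^ i) - x"

definition carlitz_D :: "nat \<Rightarrow> 'c::field \<Rightarrow> nat \<Rightarrow> 'c" where
  "carlitz_D q x i = (\<Prod>j=1..i. brk q x j ^ (q ^ (i - j)))"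

text \<open>
  Unique whenever \<open>q\<close> is a power of the characteristic, and existing in the completion of
  an algebraic closure, which is perfect.
\<close>

definition qroot :: "nat \<Rightarrow> 'c::field \<Rightarrow> 'c" where
  "qroot q a = (THE b. b ^ q = a)"

definition lin_polys :: "nat \<Rightarrow> 'c::field poly set" where
  "lin_polys q = {u. \<forall>n. poly.coeff u n \<noteq> 0 \<longrightarrow> (\<exists>k. n = q ^ k)}"

text \<open>
  The operators below are meant on \<open>lin_polys q\<close>, where \<open>u ^ q\<close> is the Frobenius
  \<open>\<tau> u\<close>. The inverse \<open>tau_inv\<close> is used only for polynomials without linear term;
  the sum covers all further coefficients, since \<open>k < q ^ k\<close>.
\<close>

definition tau :: "nat \<Rightarrow> 'c::field poly \<Rightarrow> 'c poly" where
  "tau q u = u ^ q"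

definition tau_inv :: "nat \<Rightarrow> 'c::field poly \<Rightarrow> 'c poly" where
  "tau_inv q u = (\<Sum>k=1..Polynomial.degree u. Polynomial.monom (qroot q (poly.coeff u (q ^ k))) (q ^ (k - 1)))"

definition Delta :: "'c::field \<Rightarrow> 'c poly \<Rightarrow> 'c poly" where
  "Delta x u = pcompose u [:0, x:] - Polynomial.smult x u"

definition carlitz_d :: "nat \<Rightarrow> 'c::field \<Rightarrow> 'c poly \<Rightarrow> 'c poly" where
  "carlitz_d q x u = tau_inv q (Delta x u)"

definition Delta_iter :: "nat \<Rightarrow> 'c::field \<Rightarrow> nat \<Rightarrow> 'c poly \<Rightarrow> 'c poly" where
  "Delta_iter q x l u = (tau q ^^ l) ((carlitz_d q x ^^ l) u)"

text \<open>
  On a given element of \<open>lin_polys q\<close> only finitely many \<open>Delta_iter q x l\<close> do not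
  vanish, so the series defining the next operator is a finite sum there.
\<close>

definition delta0 :: "nat \<Rightarrow> 'c::field \<Rightarrow> (nat \<Rightarrow> 'c) \<Rightarrow> 'c poly \<Rightarrow> 'c poly" where
  "delta0 q x \<sigma> u =
     (\<Sum>l | l \<ge> 1 \<and> Delta_iter q x l u \<noteq> 0. Polynomial.smult (\<sigma> l) (Delta_iter q x l u))"

definition delta :: "nat \<Rightarrow> 'c::field \<Rightarrow> (nat \<Rightarrow> 'c) \<Rightarrow> 'c poly \<Rightarrow> 'c poly" where
  "delta q x \<sigma> u = tau_inv q (delta0 q x \<sigma> u)"

definition basic_sequence ::
    "nat \<Rightarrow> 'c::field \<Rightarrow> ('c poly \<Rightarrow> 'c poly) \<Rightarrow> (nat \<Rightarrow> 'c poly) \<Rightarrow> bool" where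
  "basic_sequence q x \<delta> P \<longleftrightarrow>
     (\<forall>n. P n \<in> lin_polys q \<and> Polynomial.degree (P n) = q ^ n) \<and>
     poly (P 0) 1 = 1 \<and> (\<forall>n\<ge>1. poly (P n) 1 = 0) \<and>
     \<delta> (P 0) = 0 \<and> (\<forall>n\<ge>1. \<delta> (P n) = Polynomial.smult (qroot q (brk q x n)) (P (n - 1)))"

definition S_coeff :: "nat \<Rightarrow> 'c::field \<Rightarrow> (nat \<Rightarrow> 'c) \<Rightarrow> nat \<Rightarrow> 'c" where
  "S_coeff q x \<sigma> n = (\<Sum>l=1..n. \<sigma> l / carlitz_D q x (n - l) ^ (q ^ l))"

fun b_coeff :: "nat \<Rightarrow> 'c::field \<Rightarrow> (nat \<Rightarrow> 'c) \<Rightarrow> nat \<Rightarrow> 'c" where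
  "b_coeff q x \<sigma> 0 = 1"
| "b_coeff q x \<sigma> (Suc j) =
     b_coeff q x \<sigma> j ^ q / (carlitz_D q x (Suc j) * S_coeff q x \<sigma> (Suc j))"

fun beta_coeff :: "nat \<Rightarrow> 'c::field \<Rightarrow> (nat \<Rightarrow> 'c) \<Rightarrow> nat \<Rightarrow> 'c" where
  "beta_coeff q x \<sigma> l =
     (if l = 0 then 1
      else - (\<Sum>m=1..l. b_coeff q x \<sigma> m * beta_coeff q x \<sigma> (l - m) ^ (q ^ m)))"

declare beta_coeff.simps [simp del]

definition e_term :: "nat \<Rightarrow> 'c::field \<Rightarrow> (nat \<Rightarrow> 'c) \<Rightarrow> 'c \<Rightarrow> nat \<Rightarrow> 'c" where
  "e_term q x \<sigma> s j = b_coeff q x \<sigma> j * s ^ (q ^ j)"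

definition log_term :: "nat \<Rightarrow> 'c::field \<Rightarrow> (nat \<Rightarrow> 'c) \<Rightarrow> 'c \<Rightarrow> nat \<Rightarrow> 'c" where
  "log_term q x \<sigma> s n = beta_coeff q x \<sigma> n * s ^ (q ^ n)"

definition e_delta :: "nat \<Rightarrow> 'c::{field,topological_space} \<Rightarrow> (nat \<Rightarrow> 'c) \<Rightarrow> 'c \<Rightarrow> 'c" where
  "e_delta q x \<sigma> s = (\<Sum>j. e_term q x \<sigma> s j)"

definition log_delta :: "nat \<Rightarrow> 'c::{field,topological_space} \<Rightarrow> (nat \<Rightarrow> 'c) \<Rightarrow> 'c \<Rightarrow> 'c" where
  "log_delta q x \<sigma> s = (\<Sum>n. log_term q x \<sigma> s n)"

end

theory Submission
  imports Defs "HOL-Number_Theory.Residues"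
begin

text \<open>
  Since \<open>\<delta>\<close> acts on \<open>t ^ (q ^ n)\<close> by \<open>(D n * S n) ^ (1 / q)\<close>, comparing coefficients in
  the recursion for the basic sequence, together with the normalisation \<open>P n 1 = 0\<close>, gives
  \<open>Q n t = (\<Sum>k\<le>n. b k * \<beta> (n - k) ^ (q ^ k) * t ^ (q ^ k))\<close>. So the claim holds
  formally, by rearranging the double series for \<open>e (t * log z)\<close>. As \<open>|\<sigma> 1| = 1\<close>, the
  term \<open>l = 1\<close> dominates \<open>S n\<close> and \<open>|D n * S n| = 1 / q\<close>; hence \<open>|b n|\<close> equals, and
  \<open>|\<beta> n|\<close> is at most, \<open>q\<close> to the power \<open>(q ^ n - 1) / (q - 1)\<close>, which yields
  convergence and justifies the rearrangement.
\<close>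

section \<open>Linear polynomials over a perfect field\<close>

text \<open>Surjectivity of the Frobenius supplies the root that \<open>qroot\<close> describes; its
  uniqueness comes from the characteristic.\<close>

locale perfect_char =
  fixes q \<nu> :: nat and x :: "'c::field"
  assumes prime_char: "Factorial_Ring.prime CHAR('c)"
    and q_eq: "q = CHAR('c) ^ \<nu>"
    and q_gt_1: "1 < q"
    and ex_root: "\<exists>b. b ^ q = (a :: 'c)"
begin

section \<open>The Frobenius and its inverse\<close>

lemma q_pos: "0 < q"
  using q_gt_1 by simp

lemma q_power_eq: "q ^ k = CHAR('c) ^ (\<nu> * k)"
  by (simp add: q_eq power_mult)

lemma frob_add: "(a + b) ^ (q ^ k) = a ^ (q ^ k) + (b :: 'c) ^ (q ^ k)"
  by (rule freshmans_dream'[OF prime_char q_power_eq])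

lemma frob_sum: "sum f A ^ (q ^ k) = (\<Sum>i\<in>A. (f i :: 'c) ^ (q ^ k))"
  by (rule freshmans_dream_sum'[OF prime_char q_power_eq])

lemma frob_diff: "(a - b) ^ (q ^ k) = a ^ (q ^ k) - (b :: 'c) ^ (q ^ k)"
  using frob_add[of "a - b" b k] by (simp add: algebra_simps)

lemma frob_inj:
  assumes "a ^ q = (b :: 'c) ^ q"
  shows "a = b"
  using frob_diff[of a b 1] assms q_pos by simp

lemma qroot_power: "qroot q (a :: 'c) ^ q = a"
proof -
  obtain b where "b ^ q = a"
    using ex_root by blast
  then have "\<exists>!b. b ^ q = a"
    using frob_inj by blast
  then show ?thesis
    unfolding qroot_def by (rule theI')
qed

lemma qroot_0: "qroot q (0 :: 'c) = 0"
  using qroot_power[of 0] q_pos by simp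

lemma less_q_power: "n < q ^ n"
  using less_exp[of n] power_mono[of 2 q n] q_gt_1 by linarith

text \<open>Since \<open>n < q ^ n\<close>, cutting the sum in \<open>tau_inv\<close> at the degree
  loses no coefficient.\<close>

lemma coeff_eq_0_lin: "Polynomial.degree u \<le> n \<Longrightarrow> poly.coeff (u :: 'c poly) (q ^ Suc n) = 0"
  using less_q_power[of "Suc n"] by (intro coeff_eq_0) linarith

text \<open>The Frobenius is additive on polynomials too, so the \<open>q\<close>-th power may be
  taken monomial by monomial.\<close>

lemma coeff_power_q:
  "poly.coeff (u ^ q) n = (if q dvd n then poly.coeff (u :: 'c poly) (n div q) ^ q else 0)"
proof -
  let ?d = "Polynomial.degree u"
  have "u ^ q = (\<Sum>i\<le>?d. Polynomial.monom (poly.coeff u i) i) ^ q"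
    by (simp add: poly_as_sum_of_monoms)
  also have "\<dots> = (\<Sum>i\<le>?d. Polynomial.monom (poly.coeff u i) i ^ q)"
    by (rule freshmans_dream_sum') (use prime_char q_eq in simp_all)
  finally have "poly.coeff (u ^ q) n =
      (\<Sum>i\<le>?d. if i * q = n then poly.coeff u i ^ q else 0)"
    by (simp add: coeff_sum monom_power)
  also have "\<dots> = (if q dvd n then poly.coeff u (n div q) ^ q else 0)"
  proof (cases "q dvd n")
    case True
    then obtain m where m: "n = q * m" ..
    have "(\<Sum>i\<le>?d. if i * q = n then poly.coeff u i ^ q else 0) =
        (\<Sum>i\<le>?d. if i = m then poly.coeff u i ^ q else 0)"
      using q_pos by (intro sum.cong) (auto simp: m)
    then show ?thesis
      using m q_pos by (auto simp: coeff_eq_0)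
  next
    case False
    then show ?thesis
      by (intro trans[OF sum.neutral]) auto
  qed
  finally show ?thesis .
qed

section \<open>Coefficients of the Frobenius, its inverse and the Carlitz operators\<close>

lemma tau_lin: "u \<in> lin_polys q \<Longrightarrow> tau q (u :: 'c poly) \<in> lin_polys q"
  unfolding lin_polys_def tau_def
proof safe
  fix n assume u: "\<forall>n. poly.coeff u n \<noteq> 0 \<longrightarrow> (\<exists>k. n = q ^ k)"
    and "poly.coeff (u ^ q) n \<noteq> 0"
  then have dvd: "q dvd n" and "poly.coeff u (n div q) \<noteq> 0"
    using q_pos by (auto simp: coeff_power_q split: if_splits)
  with u obtain k where "n div q = q ^ k"
    by blast
  with dvd show "\<exists>k. n = q ^ k"
    by (intro exI[of _ "Suc k"]) (metis dvd_mult_div_cancel power_Suc)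
qed

lemma coeff_tau_Suc: "poly.coeff (tau q (u :: 'c poly)) (q ^ Suc k) = poly.coeff u (q ^ k) ^ q"
  using q_pos by (simp add: tau_def coeff_power_q)

lemma coeff_tau_iter:
  "poly.coeff ((tau q ^^ l) (u :: 'c poly)) (q ^ n) =
     (if l \<le> n then poly.coeff u (q ^ (n - l)) ^ (q ^ l) else 0)"
proof (induction l arbitrary: n)
  case (Suc l)
  show ?case
  proof (cases n)
    case 0
    then show ?thesis
      using q_gt_1 by (simp add: tau_def coeff_power_q)
  next
    case (Suc m)
    then show ?thesis
      using q_pos Suc.IH[of m] coeff_tau_Suc[of "(tau q ^^ l) u" m]
      by (simp add: mult.commute flip: power_mult)
  qed
qed simp

lemma tau_inv_lin: "tau_inv q (u :: 'c poly) \<in> lin_polys q"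
  unfolding lin_polys_def tau_inv_def
proof safe
  fix n assume "poly.coeff (\<Sum>k=1..Polynomial.degree u.
      Polynomial.monom (qroot q (poly.coeff u (q ^ k))) (q ^ (k - 1))) n \<noteq> 0"
  then show "\<exists>k. n = q ^ k"
    unfolding coeff_sum
    by (rule sum.not_neutral_contains_not_neutral) (auto split: if_splits)
qed

lemma coeff_tau_inv:
  "poly.coeff (tau_inv q (u :: 'c poly)) (q ^ k) = qroot q (poly.coeff u (q ^ Suc k))"
proof -
  let ?d = "Polynomial.degree u"
  have "poly.coeff (tau_inv q u) (q ^ k) =
      (\<Sum>i=1..?d. if i = Suc k then qroot q (poly.coeff u (q ^ i)) else 0)"
    unfolding tau_inv_def coeff_sum by (rule sum.cong) (use q_gt_1 in auto)
  also have "\<dots> = qroot q (poly.coeff u (q ^ Suc k))"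
    using coeff_eq_0_lin[of u k] by (auto simp: qroot_0 simp del: power_Suc)
  finally show ?thesis .
qed

lemma coeff_Delta: "poly.coeff (Delta x u) (q ^ k) = brk q x k * poly.coeff u (q ^ k)"
  by (simp add: Delta_def coeff_pcompose_linear brk_def algebra_simps)

text \<open>Stating the \<open>q\<close>-th power of the coefficient keeps \<open>qroot\<close> out
  of all later computations.\<close>

lemma coeff_carlitz_d:
  "poly.coeff (carlitz_d q x u) (q ^ k) ^ q = brk q x (Suc k) * poly.coeff u (q ^ Suc k)"
  by (simp only: carlitz_d_def coeff_tau_inv coeff_Delta qroot_power)

lemma carlitz_D_0 [simp]: "carlitz_D q x 0 = 1"
  by (simp add: carlitz_D_def)

lemma carlitz_D_Suc: "carlitz_D q x (Suc n) = brk q x (Suc n) * carlitz_D q x n ^ q"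
proof -
  have "carlitz_D q x (Suc n) = (\<Prod>j=1..n. brk q x j ^ (q ^ (Suc n - j))) * brk q x (Suc n)"
    by (simp add: carlitz_D_def)
  also have "(\<Prod>j=1..n. brk q x j ^ (q ^ (Suc n - j))) = carlitz_D q x n ^ q"
    unfolding carlitz_D_def prod_power_distrib
    by (rule prod.cong) (auto simp: Suc_diff_le mult.commute simp flip: power_mult)
  finally show ?thesis
    by simp
qed

text \<open>Each application of \<open>carlitz_d\<close> contributes one bracket, which
  \<open>carlitz_D_Suc\<close> absorbs into the next \<open>carlitz_D\<close>. The multiplicative
  form avoids dividing by brackets.\<close>

lemma coeff_carlitz_d_iter:
  "poly.coeff ((carlitz_d q x ^^ l) u) (q ^ k) ^ (q ^ l) * carlitz_D q x k ^ (q ^ l) =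
     carlitz_D q x (k + l) * poly.coeff u (q ^ (k + l))"
proof (induction l arbitrary: k)
  case (Suc l)
  let ?v = "(carlitz_d q x ^^ l) u"
  have "poly.coeff (carlitz_d q x ?v) (q ^ k) ^ (q ^ Suc l) * carlitz_D q x k ^ (q ^ Suc l) =
      (poly.coeff (carlitz_d q x ?v) (q ^ k) ^ q * carlitz_D q x k ^ q) ^ (q ^ l)"
    by (simp add: power_mult power_mult_distrib)
  also have "\<dots> = poly.coeff ?v (q ^ Suc k) ^ (q ^ l) * carlitz_D q x (Suc k) ^ (q ^ l)"
    by (simp only: coeff_carlitz_d carlitz_D_Suc) (simp add: power_mult_distrib mult_ac)
  also have "\<dots> = carlitz_D q x (Suc k + l) * poly.coeff u (q ^ (Suc k + l))"
    by (rule Suc.IH)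
  finally show ?case
    by simp
qed simp

lemma Delta_iter_lin: "u \<in> lin_polys q \<Longrightarrow> Delta_iter q x l u \<in> lin_polys q"
proof -
  assume u: "u \<in> lin_polys q"
  have "(carlitz_d q x ^^ l) u \<in> lin_polys q"
    by (cases l) (auto simp: u carlitz_d_def tau_inv_lin)
  then have "(tau q ^^ m) ((carlitz_d q x ^^ l) u) \<in> lin_polys q" for m
    by (induction m) (auto simp: tau_lin)
  then show ?thesis
    by (simp add: Delta_iter_def)
qed

lemma lin_polys_eqI:
  assumes "u \<in> lin_polys q" "v \<in> lin_polys q"
    and "\<And>k. poly.coeff u (q ^ k) = poly.coeff v (q ^ k)"
  shows "u = v"
proof (rule poly_eqI)
  fix n
  show "poly.coeff u n = poly.coeff v n"
  proof (cases "\<exists>k. n = q ^ k")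
    case True
    then show ?thesis
      using assms(3) by auto
  next
    case False
    then have "poly.coeff u n = 0" "poly.coeff v n = 0"
      using assms(1,2) unfolding lin_polys_def by blast+
    then show ?thesis
      by simp
  qed
qed

lemma zero_lin: "0 \<in> lin_polys q"
  by (simp add: lin_polys_def)

lemma poly_lin:
  assumes u: "u \<in> lin_polys q" and deg: "Polynomial.degree u \<le> q ^ n"
  shows "poly u s = (\<Sum>k\<le>n. poly.coeff u (q ^ k) * s ^ (q ^ k))"
proof -
  have "poly u s = (\<Sum>i\<le>q ^ n. poly.coeff u i * s ^ i)"
    unfolding poly_altdef
    by (rule sum.mono_neutral_left) (use deg in \<open>auto simp: coeff_eq_0\<close>)
  also have "\<dots> = (\<Sum>i\<in>(\<lambda>k. q ^ k) ` {..n}. poly.coeff u i * s ^ i)"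
  proof (rule sum.mono_neutral_right)
    have "poly.coeff u i = 0" if "i \<le> q ^ n" "i \<notin> (\<lambda>k. q ^ k) ` {..n}" for i
    proof (rule ccontr)
      assume "poly.coeff u i \<noteq> 0"
      then obtain k where k: "i = q ^ k"
        using u unfolding lin_polys_def by blast
      with \<open>i \<le> q ^ n\<close> have "k \<le> n"
        using q_gt_1 by simp
      with k that show False
        by blast
    qed
    then show "\<forall>i\<in>{..q ^ n} - (\<lambda>k. q ^ k) ` {..n}. poly.coeff u i * s ^ i = 0"
      by auto
  qed (use q_gt_1 in auto)
  also have "\<dots> = (\<Sum>k\<le>n. poly.coeff u (q ^ k) * s ^ (q ^ k))"
    by (subst sum.reindex) (use q_gt_1 in \<open>auto simp: inj_on_def\<close>)
  finally show ?thesis .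
qed

end

text \<open>Nonzero brackets make every \<open>carlitz_D q x n\<close> invertible. In the valued
  setting below this follows from \<open>av_brk\<close>.\<close>

locale carlitz_field = perfect_char +
  assumes brk_nonzero: "i \<ge> 1 \<Longrightarrow> brk q x i \<noteq> 0"
begin

section \<open>Diagonal action of the delta operator and its basic sequence\<close>

lemma carlitz_D_nonzero: "carlitz_D q x n \<noteq> 0"
  by (induction n) (auto simp: carlitz_D_Suc brk_nonzero)

lemma coeff_Delta_iter:
  "poly.coeff (Delta_iter q x l u) (q ^ n) =
     (if l \<le> n then carlitz_D q x n / carlitz_D q x (n - l) ^ (q ^ l) * poly.coeff u (q ^ n)
      else 0)"
  using coeff_carlitz_d_iter[of l u "n - l"] carlitz_D_nonzero[of "n - l"]
  by (auto simp: Delta_iter_def coeff_tau_iter field_simps)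

text \<open>Below index \<open>l\<close> the factor in \<open>coeff_Delta_iter\<close> vanishes;
  from \<open>l\<close> on, the coefficient of \<open>u\<close> does. This makes the index set in
  \<open>delta0\<close> finite.\<close>

lemma Delta_iter_eq_0:
  assumes u: "u \<in> lin_polys q" and l: "Polynomial.degree u < l"
  shows "Delta_iter q x l u = 0"
proof (rule lin_polys_eqI[OF Delta_iter_lin[OF u] zero_lin])
  fix k
  have "poly.coeff u (q ^ k) = 0" if "l \<le> k"
    using l that less_q_power[of k] by (intro coeff_eq_0) linarith
  then show "poly.coeff (Delta_iter q x l u) (q ^ k) = poly.coeff 0 (q ^ k)"
    by (simp add: coeff_Delta_iter)
qed

lemma coeff_delta0:
  assumes u: "u \<in> lin_polys q"
  shows "poly.coeff (delta0 q x \<sigma> u) (q ^ n) =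
    carlitz_D q x n * S_coeff q x \<sigma> n * poly.coeff u (q ^ n)"
proof -
  let ?c = "\<lambda>l. \<sigma> l * poly.coeff (Delta_iter q x l u) (q ^ n)"
  let ?A = "{l. l \<ge> 1 \<and> Delta_iter q x l u \<noteq> 0}"
  have fin: "finite ?A"
    by (rule finite_subset[of _ "{..Polynomial.degree u}"])
       (use Delta_iter_eq_0[OF u] not_le in auto)
  have "poly.coeff (delta0 q x \<sigma> u) (q ^ n) = sum ?c ?A"
    by (simp add: delta0_def coeff_sum)
  \<comment> \<open>The set \<open>?A\<close> depends on \<open>u\<close>; passing through the union
    trades it for \<open>{1..n}\<close>, as indices outside \<open>?A\<close> or above
    \<open>n\<close> contribute zero.\<close>
  also have "\<dots> = sum ?c (?A \<union> {1..n})"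
    by (rule sum.mono_neutral_left) (use fin in auto)
  also have "\<dots> = sum ?c {1..n}"
    by (rule sum.mono_neutral_right) (use fin in \<open>auto simp: coeff_Delta_iter\<close>)
  also have "\<dots> = carlitz_D q x n * S_coeff q x \<sigma> n * poly.coeff u (q ^ n)"
    by (simp add: coeff_Delta_iter S_coeff_def sum_distrib_left sum_distrib_right mult_ac)
  finally show ?thesis .
qed

lemma coeff_delta:
  assumes "u \<in> lin_polys q"
  shows "poly.coeff (delta q x \<sigma> u) (q ^ n) ^ q =
    carlitz_D q x (Suc n) * S_coeff q x \<sigma> (Suc n) * poly.coeff u (q ^ Suc n)"
  by (simp only: delta_def coeff_tau_inv qroot_power coeff_delta0[OF assms])

text \<open>Coefficient form of the identity that \<open>e_delta\<close> composed with
  \<open>log_delta\<close> is the identity series.\<close>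

lemma sum_b_beta: "(\<Sum>k\<le>n. b_coeff q x \<sigma> k * beta_coeff q x \<sigma> (n - k) ^ (q ^ k)) =
    (if n = 0 then 1 else 0)"
proof (cases "n = 0")
  case False
  have "{..n} = insert 0 {1..n}"
    by auto
  then show ?thesis
    using False beta_coeff.simps[of q x \<sigma> n] by simp
qed (simp add: beta_coeff.simps)

lemma coeff_basic_sequence:
  assumes basic: "basic_sequence q x (delta q x \<sigma>) P"
    and S: "\<And>n. n \<ge> 1 \<Longrightarrow> S_coeff q x \<sigma> n \<noteq> 0"
    and "k \<le> n"
  shows "poly.coeff (P n) (q ^ k) =
    carlitz_D q x n * (b_coeff q x \<sigma> k * beta_coeff q x \<sigma> (n - k) ^ (q ^ k))"
  using \<open>k \<le> n\<close>
proof (induction n arbitrary: k)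
  case 0
  have "poly (P 0) 1 = poly.coeff (P 0) (q ^ 0)"
    using basic poly_lin[of "P 0" 0 1] by (simp add: basic_sequence_def)
  then show ?case
    using basic 0 by (simp add: basic_sequence_def beta_coeff.simps)
next
  case (Suc m)
  let ?D = "carlitz_D q x (Suc m)"
  let ?r = "\<lambda>k. b_coeff q x \<sigma> k * beta_coeff q x \<sigma> (Suc m - k) ^ (q ^ k)"
  have lin: "P (Suc m) \<in> lin_polys q" and deg: "Polynomial.degree (P (Suc m)) = q ^ Suc m"
    and one: "poly (P (Suc m)) 1 = 0"
    and del: "delta q x \<sigma> (P (Suc m)) = Polynomial.smult (qroot q (brk q x (Suc m))) (P m)"
    using basic unfolding basic_sequence_def by (simp_all del: power_Suc)
  have step: "poly.coeff (P (Suc m)) (q ^ Suc j) = ?D * ?r (Suc j)" if "j \<le> m" for j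
  proof -
    let ?T = "carlitz_D q x (Suc j) * S_coeff q x \<sigma> (Suc j)"
    let ?\<beta> = "beta_coeff q x \<sigma> (m - j)"
    \<comment> \<open>The recursion for \<open>P\<close> is compared at \<open>q ^ j\<close> after
      taking \<open>q\<close>-th powers, which clears all roots. Then \<open>carlitz_D_Suc\<close>
      yields \<open>?D\<close>, and division by \<open>?T\<close> turns \<open>b_j ^ q\<close> into
      \<open>b_(j+1)\<close>.\<close>
    have "?T * poly.coeff (P (Suc m)) (q ^ Suc j) =
        brk q x (Suc m) * poly.coeff (P m) (q ^ j) ^ q"
      using coeff_delta[OF lin, of \<sigma> j] by (simp add: del power_mult_distrib qroot_power)
    also have "\<dots> = ?D * (b_coeff q x \<sigma> j ^ q * ?\<beta> ^ (q ^ Suc j))"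
      by (simp add: Suc.IH[OF that] carlitz_D_Suc power_mult_distrib mult_ac flip: power_mult)
    finally show ?thesis
      using S[of "Suc j"] carlitz_D_nonzero[of "Suc j"] by (simp add: field_simps)
  qed
  show ?case
  proof (cases k)
    case 0
    \<comment> \<open>The linear coefficient is invisible to \<open>delta\<close>. It is found by
      comparing two vanishing sums, \<open>P (Suc m)\<close> at 1 and \<open>sum_b_beta\<close>,
      whose terms of positive index agree by \<open>step\<close>.\<close>
    have "poly.coeff (P (Suc m)) (q ^ 0) + (\<Sum>j\<le>m. ?D * ?r (Suc j)) =
        (\<Sum>k\<le>Suc m. poly.coeff (P (Suc m)) (q ^ k))"
      unfolding sum.atMost_Suc_shift by (simp add: step del: power_Suc)
    also have "\<dots> = 0"
      using poly_lin[OF lin, of "Suc m" 1] by (simp only: deg one power_one mult_1_right)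
    also have "0 = ?D * (\<Sum>k\<le>Suc m. ?r k)"
      by (simp only: sum_b_beta) simp
    also have "\<dots> = ?D * ?r 0 + (\<Sum>j\<le>m. ?D * ?r (Suc j))"
      unfolding sum.atMost_Suc_shift by (simp only: sum_distrib_left distrib_left)
    finally show ?thesis
      unfolding 0 by (simp only: add_right_cancel)
  next
    case (Suc j)
    then show ?thesis
      using step[of j] Suc.prems by simp
  qed
qed

end

section \<open>Series in a complete ultrametric field\<close>

text \<open>Nonnegativity and definiteness of \<open>av\<close> are inherited from the metric
  through \<open>dist_av\<close>.\<close>

locale ultrametric_field =
  fixes av :: "'c::{field,complete_space} \<Rightarrow> real"
  assumes dist_av: "dist u v = av (u - v)"
    and av_mult: "av (u * v) = av u * av v"
    and av_ultrametric: "av (u + v) \<le> max (av u) (av v)"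
begin

lemma av_0 [simp]: "av 0 = 0"
  using dist_av[of 0 0] by simp

lemma av_nonneg [simp]: "0 \<le> av u"
  using dist_av[of u 0] by (metis diff_zero zero_le_dist)

lemma av_eq_0_iff [simp]: "av u = 0 \<longleftrightarrow> u = 0"
  using dist_av[of u 0] by (metis diff_zero dist_eq_0_iff)

lemma av_1 [simp]: "av 1 = 1"
  using av_mult[of 1 1] by simp

lemma av_minus [simp]: "av (- u) = av u"
  using dist_av[of 0 u] dist_av[of u 0] dist_commute[of 0 u] by simp

lemma av_power: "av (u ^ n) = av u ^ n"
  by (induction n) (simp_all add: av_mult)

lemma av_divide: "av (u / v) = av u / av v"
proof (cases "v = 0")
  case False
  then show ?thesis
    using av_mult[of "u / v" v] by (simp add: field_simps)
qed simp

lemma av_diff_le: "av (u - v) \<le> max (av u) (av v)"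
  using av_ultrametric[of u "- v"] by simp

text \<open>Isosceles principle: writing \<open>u\<close> as \<open>(u + v) - v\<close> bounds
  \<open>av u\<close> by the larger of \<open>av (u + v)\<close> and \<open>av v\<close>, and the
  latter is too small.\<close>

lemma av_add_eq:
  assumes "av v < av u"
  shows "av (u + v) = av u"
  using av_ultrametric[of u v] av_diff_le[of "u + v" v] assms by auto

lemma av_sum_le:
  assumes "\<And>i. i \<in> A \<Longrightarrow> av (f i) \<le> C" and "0 \<le> C"
  shows "av (sum f A) \<le> C"
  using assms(1)
proof (induction A rule: infinite_finite_induct)
  case (insert i A)
  then have "max (av (f i)) (av (sum f A)) \<le> C"
    by simp
  with av_ultrametric have "av (f i + sum f A) \<le> C"
    by (rule order_trans)
  then show ?case
    using insert.hyps by simp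
qed (use \<open>0 \<le> C\<close> in simp_all)

lemma partial_sum_diff_le:
  fixes f :: "nat \<Rightarrow> 'c"
  assumes "\<And>n. n \<ge> k \<Longrightarrow> av (f n) \<le> C" and "0 \<le> C" and "k \<le> m"
  shows "av (sum f {..<m} - sum f {..<k}) \<le> C"
proof -
  have "sum f {..<m} - sum f {..<k} = sum f ({..<m} - {..<k})"
    using \<open>k \<le> m\<close> by (subst sum_diff) auto
  then show ?thesis
    using assms by (auto intro!: av_sum_le)
qed

text \<open>By the ultrametric inequality a block of terms is no larger than its largest term, so
  null terms already give Cauchy partial sums.\<close>

lemma summable_av:
  assumes "(\<lambda>n. av (f n)) \<longlonglongrightarrow> 0"
  shows "summable f"
proof -
  have "Cauchy (\<lambda>n. sum f {..<n})"
  proof (rule CauchyI')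
    fix e :: real assume "0 < e"
    then have "\<forall>\<^sub>F n in sequentially. av (f n) < e / 2"
      using order_tendstoD(2)[OF assms, of "e / 2"] by simp
    then obtain N where N: "\<And>n. n \<ge> N \<Longrightarrow> av (f n) < e / 2"
      unfolding eventually_sequentially by blast
    have "dist (sum f {..<m}) (sum f {..<n}) < e" if "N \<le> m" "m < n" for m n
    proof -
      have "av (sum f {..<n} - sum f {..<m}) \<le> e / 2"
        using N that \<open>0 < e\<close> by (intro partial_sum_diff_le) (auto intro: less_imp_le)
      then show ?thesis
        using \<open>0 < e\<close> by (subst dist_commute) (simp add: dist_av)
    qed
    then show "\<exists>M. \<forall>m\<ge>M. \<forall>n>m. dist (sum f {..<m}) (sum f {..<n}) < e"
      by blast
  qed
  then show ?thesis
    by (auto simp: summable_def sums_def convergent_def dest: Cauchy_convergent)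
qed

lemma suminf_tail_le:
  assumes f: "summable f" and C: "\<And>n. n \<ge> k \<Longrightarrow> av (f n) \<le> C" "0 \<le> C"
  shows "av (suminf f - sum f {..<k}) \<le> C"
proof (rule field_le_epsilon)
  fix e :: real assume "0 < e"
  then have "\<forall>\<^sub>F n in sequentially. dist (sum f {..<n}) (suminf f) < e"
    using summable_LIMSEQ[OF f] by (simp add: tendsto_iff)
  then obtain n where n: "n \<ge> k" "dist (suminf f) (sum f {..<n}) < e"
    unfolding eventually_sequentially by (metis dist_commute nle_le)
  have "av (suminf f - sum f {..<k}) \<le>
      max (av (suminf f - sum f {..<n})) (av (sum f {..<n} - sum f {..<k}))"
    using av_ultrametric[of "suminf f - sum f {..<n}" "sum f {..<n} - sum f {..<k}"] by simp
  also have "\<dots> \<le> max e C"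
    using n partial_sum_diff_le[OF C \<open>n \<ge> k\<close>] by (simp add: dist_av max.coboundedI1 max.coboundedI2)
  also have "\<dots> \<le> C + e"
    using \<open>0 < e\<close> C(2) by simp
  finally show "av (suminf f - sum f {..<k}) \<le> C + e" .
qed

lemma tendsto_av_diff:
  assumes g: "g \<longlonglongrightarrow> l" and fg: "(\<lambda>n. av (f n - g n)) \<longlonglongrightarrow> 0"
  shows "f \<longlonglongrightarrow> l"
proof -
  have "(\<lambda>n. dist (f n) (g n) + dist (g n) l) \<longlonglongrightarrow> 0 + 0"
    using fg g by (intro tendsto_add) (simp_all add: dist_av tendsto_dist_iff[of g])
  then have "(\<lambda>n. dist (f n) l) \<longlonglongrightarrow> 0"
    by (intro tendsto_sandwich[of "\<lambda>_. 0" "\<lambda>n. dist (f n) l"]) (auto intro!: always_eventually dist_triangle)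
  then show ?thesis
    by (subst tendsto_dist_iff)
qed

end

section \<open>The deformed exponential and logarithm\<close>

text \<open>Both sides run over the pairs \<open>(k, i)\<close> with
  \<open>k + i < M\<close>.\<close>

lemma sum_triangle:
  fixes f :: "nat \<Rightarrow> nat \<Rightarrow> 'a::comm_monoid_add"
  shows "(\<Sum>n<M. \<Sum>k\<le>n. f k (n - k)) = (\<Sum>k<M. \<Sum>i<M - k. f k i)"
proof (induction M)
  case (Suc M)
  have "(\<Sum>k<M. \<Sum>i<Suc M - k. f k i) = (\<Sum>k<M. (\<Sum>i<M - k. f k i) + f k (M - k))"
    by (rule sum.cong) (auto simp: Suc_diff_le)
  then show ?case
    by (simp add: sum.distrib flip: Suc.IH) (simp add: add_ac flip: lessThan_Suc_atMost)
qed simp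

lemma tendsto_power_power_0:
  fixes w :: real
  assumes "0 \<le> w" "w < 1" and "\<And>n. n \<le> f n"
  shows "(\<lambda>n. w ^ f n) \<longlonglongrightarrow> 0"
proof (rule tendsto_sandwich[OF _ _ tendsto_const])
  show "(\<lambda>n. w ^ n) \<longlonglongrightarrow> 0"
    using assms by (intro LIMSEQ_realpow_zero) auto
qed (use assms in \<open>auto intro!: always_eventually power_decreasing\<close>)

locale carlitz_series = ultrametric_field av + perfect_char q \<nu> x
  for av :: "'c::{field,complete_space} \<Rightarrow> real" and q \<nu> x +
  fixes \<sigma> :: "nat \<Rightarrow> 'c"
  assumes av_x: "av x = 1 / real q"
    and av_sigma_1: "av (\<sigma> 1) = 1"
    and av_sigma: "l \<ge> 1 \<Longrightarrow> av (\<sigma> l) \<le> 1"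
begin

text \<open>As \<open>av x < 1\<close>, the summand \<open>- x\<close> strictly dominates
  \<open>x ^ (q ^ i)\<close>.\<close>

lemma av_brk: "i \<ge> 1 \<Longrightarrow> av (brk q x i) = 1 / real q"
proof -
  assume "i \<ge> 1"
  then have "1 < q ^ i"
    using q_gt_1 by (intro one_less_power) auto
  then have "(1 / real q) ^ (q ^ i) < (1 / real q) ^ 1"
    using q_gt_1 by (intro power_strict_decreasing) auto
  then have "av (x ^ (q ^ i)) < av (- x)"
    by (simp add: av_power av_x)
  then show ?thesis
    using av_add_eq[of "x ^ (q ^ i)" "- x"] by (simp add: brk_def av_x)
qed

sublocale carlitz_field
proof
  show "brk q x i \<noteq> 0" if "1 \<le> i" for i
    using av_brk[OF that] q_pos by auto
qed

text \<open>
  The radius of convergence of both series is \<open>1 / c\<close>. In terms of \<open>c\<close>, the exponent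
  \<open>(q ^ n - 1) / (q - 1)\<close> of \<open>q\<close> in the absolute values below becomes \<open>q ^ n - 1\<close>.
\<close>

definition c :: real where
  "c = root (q - 1) (real q)"

lemma c_gt_1: "1 < c"
  using q_gt_1 by (simp add: c_def)

lemma c_power_q: "c ^ q = real q * c"
proof -
  have "c ^ (q - 1) = real q"
    using q_gt_1 by (simp add: c_def)
  then show ?thesis
    using q_pos by (metis power_minus_mult)
qed

lemma av_carlitz_D: "av (carlitz_D q x n) = c / c ^ (q ^ n)"
proof (induction n)
  case (Suc n)
  have "av (carlitz_D q x (Suc n)) = (c / c ^ (q ^ n)) ^ q / real q"
    using av_brk[of "Suc n"] by (simp add: carlitz_D_Suc av_mult av_power Suc.IH)
  also have "\<dots> = c ^ q / real q / c ^ (q ^ Suc n)"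
    by (simp add: power_divide mult.commute flip: power_mult)
  also have "c ^ q / real q = c"
    using q_pos by (simp add: c_power_q)
  finally show ?case .
qed (use c_gt_1 in simp)

text \<open>The \<open>l\<close>-th summand has absolute value
  \<open>av (\<sigma> l) * c ^ (q ^ n) / c ^ (q ^ l)\<close>, whose weight strictly decreases in
  \<open>l\<close>.\<close>

lemma av_S_coeff: "n \<ge> 1 \<Longrightarrow> av (S_coeff q x \<sigma> n) = c ^ (q ^ n) / c ^ q"
proof -
  assume n: "n \<ge> 1"
  let ?s = "\<lambda>l. \<sigma> l / carlitz_D q x (n - l) ^ (q ^ l)"
  have av_s: "av (?s l) = av (\<sigma> l) * (c ^ (q ^ n) / c ^ (q ^ l))" if "l \<le> n" for l
  proof -
    have "(c ^ (q ^ (n - l))) ^ (q ^ l) = c ^ (q ^ n)"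
      using that by (simp flip: power_mult power_add)
    then show ?thesis
      by (simp add: av_divide av_power av_carlitz_D power_divide)
  qed
  \<comment> \<open>For \<open>n = 1\<close> this sum is empty and the bound is trivial.\<close>
  have "av (sum ?s {2..n}) \<le> c ^ (q ^ n) / c ^ (q ^ 2)"
  proof (rule av_sum_le)
    fix l assume l: "l \<in> {2..n}"
    have "c ^ (q ^ n) / c ^ (q ^ l) \<le> c ^ (q ^ n) / c ^ (q ^ 2)"
      using c_gt_1 q_gt_1 l by (intro divide_left_mono power_increasing mult_pos_pos) auto
    moreover have "av (\<sigma> l) * (c ^ (q ^ n) / c ^ (q ^ l)) \<le> 1 * (c ^ (q ^ n) / c ^ (q ^ l))"
      using c_gt_1 l by (intro mult_right_mono av_sigma) auto
    ultimately show "av (?s l) \<le> c ^ (q ^ n) / c ^ (q ^ 2)"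
      using av_s[of l] l by simp
  qed (use c_gt_1 in simp)
  also have "\<dots> < c ^ (q ^ n) / c ^ (q ^ 1)"
    using c_gt_1 q_gt_1
    by (intro divide_strict_left_mono power_strict_increasing mult_pos_pos)
       (auto simp: power2_eq_square)
  also have "\<dots> = av (?s 1)"
    using av_s[OF n] av_sigma_1 by simp
  finally have "av (?s 1 + sum ?s {2..n}) = av (?s 1)"
    by (rule av_add_eq)
  moreover have "S_coeff q x \<sigma> n = ?s 1 + sum ?s {2..n}"
    using n by (simp add: S_coeff_def sum.atLeast_Suc_atMost numeral_2_eq_2)
  ultimately show ?thesis
    using av_s[OF n] av_sigma_1 by simp
qed

lemma S_coeff_nonzero: "n \<ge> 1 \<Longrightarrow> S_coeff q x \<sigma> n \<noteq> 0"
  using av_S_coeff[of n] c_gt_1 by auto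

lemma av_b_coeff: "av (b_coeff q x \<sigma> j) = c ^ (q ^ j) / c"
proof (induction j)
  case (Suc j)
  \<comment> \<open>The powers \<open>c ^ (q ^ Suc j)\<close> cancel, so the denominator in the
    recursion has the same absolute value \<open>c / c ^ q = 1 / q\<close> for every
    \<open>j\<close>.\<close>
  have "av (carlitz_D q x (Suc j) * S_coeff q x \<sigma> (Suc j)) = c / c ^ q"
    using av_S_coeff[of "Suc j"] c_gt_1 by (simp add: av_mult av_carlitz_D)
  then have "av (b_coeff q x \<sigma> (Suc j)) = (c ^ (q ^ j) / c) ^ q / (c / c ^ q)"
    by (simp add: av_divide av_power Suc.IH)
  also have "\<dots> = c ^ (q ^ Suc j) / c"
    using c_gt_1 by (simp add: power_divide mult.commute flip: power_mult)
  finally show ?case .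
qed (use c_gt_1 in simp)

text \<open>Bounds of the shape \<open>w ^ (q ^ n) / c\<close> are stable: the factor
  \<open>c ^ (q ^ m)\<close> of \<open>b_m\<close> cancels the power of the denominator. It serves
  the coefficients of the logarithm with \<open>w = c\<close> and the error terms with
  \<open>w = c * av z\<close>.\<close>

lemma av_b_mult_le:
  assumes "av u \<le> w ^ (q ^ n) / c"
  shows "av (b_coeff q x \<sigma> m * u ^ (q ^ m)) \<le> w ^ (q ^ (m + n)) / c"
proof -
  have "av (b_coeff q x \<sigma> m * u ^ (q ^ m)) = c ^ (q ^ m) / c * av u ^ (q ^ m)"
    by (simp add: av_mult av_power av_b_coeff)
  also have "\<dots> \<le> c ^ (q ^ m) / c * (w ^ (q ^ n) / c) ^ (q ^ m)"
    using assms c_gt_1 by (intro mult_left_mono power_mono) auto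
  also have "\<dots> = w ^ (q ^ (m + n)) / c"
    using c_gt_1 by (simp add: power_divide power_add mult.commute flip: power_mult)
  finally show ?thesis .
qed

lemma av_beta_coeff: "av (beta_coeff q x \<sigma> l) \<le> c ^ (q ^ l) / c"
proof (induction l rule: less_induct)
  case (less l)
  show ?case
  proof (cases "l = 0")
    case False
    have "av (\<Sum>m=1..l. b_coeff q x \<sigma> m * beta_coeff q x \<sigma> (l - m) ^ (q ^ m)) \<le> c ^ (q ^ l) / c"
    proof (rule av_sum_le)
      fix m assume m: "m \<in> {1..l}"
      then have "av (beta_coeff q x \<sigma> (l - m)) \<le> c ^ (q ^ (l - m)) / c"
        by (intro less) auto
      \<comment> \<open>The exponent becomes \<open>m + (l - m) = l\<close>, so every summand obeys
        the same bound.\<close>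
      from av_b_mult_le[OF this, of m]
      show "av (b_coeff q x \<sigma> m * beta_coeff q x \<sigma> (l - m) ^ (q ^ m)) \<le> c ^ (q ^ l) / c"
        using m by simp
    qed (use c_gt_1 in simp)
    then show ?thesis
      using False by (simp add: beta_coeff.simps[of q x \<sigma> l])
  qed (use c_gt_1 in \<open>simp add: beta_coeff.simps\<close>)
qed

section \<open>Convergence of the exponential and the logarithm\<close>

lemma av_log_term: "av (log_term q x \<sigma> s n) \<le> (c * av s) ^ (q ^ n) / c"
  using mult_right_mono[OF av_beta_coeff, of "av s ^ (q ^ n)" n]
  by (simp add: log_term_def av_mult av_power power_mult_distrib)

lemma summable_le_power:
  assumes "c * av s < 1" and "\<And>n. av (f n) \<le> (c * av s) ^ (q ^ n) / c"
  shows "summable f"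
proof (rule summable_av, rule tendsto_sandwich[OF _ _ tendsto_const])
  have "(\<lambda>n. (c * av s) ^ (q ^ n)) \<longlonglongrightarrow> 0"
    using assms(1) c_gt_1 by (intro tendsto_power_power_0 less_imp_le[OF less_q_power]) auto
  from tendsto_divide_zero[OF this] show "(\<lambda>n. (c * av s) ^ (q ^ n) / c) \<longlonglongrightarrow> 0" .
qed (use assms(2) in auto)

lemma summable_e_term: "c * av s < 1 \<Longrightarrow> summable (e_term q x \<sigma> s)"
  by (rule summable_le_power[where s = s])
     (simp_all add: e_term_def av_mult av_power av_b_coeff power_mult_distrib)

lemma summable_log_term: "c * av s < 1 \<Longrightarrow> summable (log_term q x \<sigma> s)"
  by (rule summable_le_power[OF _ av_log_term])

text \<open>The majorants in \<open>av_log_term\<close> decrease, so the one of the first omitted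
  term bounds the whole tail.\<close>

lemma log_delta_tail:
  assumes "c * av z < 1"
  shows "av (log_delta q x \<sigma> z - (\<Sum>i<k. log_term q x \<sigma> z i)) \<le> (c * av z) ^ (q ^ k) / c"
  unfolding log_delta_def
proof (rule suminf_tail_le[OF summable_log_term[OF assms]])
  fix n assume "k \<le> n"
  have "(c * av z) ^ (q ^ n) \<le> (c * av z) ^ (q ^ k)"
    by (rule power_decreasing) (use \<open>k \<le> n\<close> assms c_gt_1 q_gt_1 in auto)
  then have "(c * av z) ^ (q ^ n) / c \<le> (c * av z) ^ (q ^ k) / c"
    using c_gt_1 by (intro divide_right_mono) auto
  then show "av (log_term q x \<sigma> z n) \<le> (c * av z) ^ (q ^ k) / c"
    by (rule order_trans[OF av_log_term])
qed (use c_gt_1 in simp)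

lemma av_log_delta_le: "c * av z < 1 \<Longrightarrow> av (log_delta q x \<sigma> z) \<le> av z"
  using log_delta_tail[of z 0] c_gt_1 by simp

lemma mult_log_delta_less:
  assumes "av t \<le> 1" "c * av z < 1"
  shows "c * av (t * log_delta q x \<sigma> z) < 1"
proof -
  have "av t * av (log_delta q x \<sigma> z) \<le> 1 * av z"
    using assms by (intro mult_mono av_log_delta_le) auto
  then have "c * av (t * log_delta q x \<sigma> z) \<le> c * av z"
    using c_gt_1 by (simp add: av_mult)
  then show ?thesis
    using assms(2) by simp
qed

lemma poly_basic_sequence:
  assumes "basic_sequence q x (delta q x \<sigma>) P"
  shows "poly (Polynomial.smult (1 / carlitz_D q x n) (P n)) t =
    (\<Sum>k\<le>n. b_coeff q x \<sigma> k * beta_coeff q x \<sigma> (n - k) ^ (q ^ k) * t ^ (q ^ k))"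
proof -
  have "P n \<in> lin_polys q" "Polynomial.degree (P n) = q ^ n"
    using assms by (auto simp: basic_sequence_def)
  then have "poly (P n) t = (\<Sum>k\<le>n. poly.coeff (P n) (q ^ k) * t ^ (q ^ k))"
    by (intro poly_lin) auto
  also have "\<dots> = carlitz_D q x n *
      (\<Sum>k\<le>n. b_coeff q x \<sigma> k * beta_coeff q x \<sigma> (n - k) ^ (q ^ k) * t ^ (q ^ k))"
    unfolding sum_distrib_left
    by (rule sum.cong) (auto simp: coeff_basic_sequence[OF assms S_coeff_nonzero] mult_ac)
  finally show ?thesis
    using carlitz_D_nonzero[of n] by simp
qed

text \<open>
  By additivity of the Frobenius, the \<open>M\<close>-th partial sum equals
  \<open>\<Sum>k<M. b k * (t * L (M - k)) ^ (q ^ k)\<close> for the partial sums \<open>L\<close> of the logarithm.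
  Replacing each \<open>L (M - k)\<close> by its limit changes every summand by at most
  \<open>(c * av z) ^ (q ^ M) / c\<close>, uniformly in \<open>k\<close>.
\<close>

theorem basic_sequence_sums:
  assumes basic: "basic_sequence q x (delta q x \<sigma>) P"
    and t: "av t \<le> 1" and z: "c * av z < 1"
  shows "(\<lambda>n. poly (Polynomial.smult (1 / carlitz_D q x n) (P n)) t * z ^ (q ^ n)) sums
    e_delta q x \<sigma> (t * log_delta q x \<sigma> z)"
  unfolding sums_def
proof (rule tendsto_av_diff)
  let ?l = "log_delta q x \<sigma> z"
  let ?L = "\<lambda>k. \<Sum>i<k. log_term q x \<sigma> z i"
  let ?A = "\<lambda>M. \<Sum>n<M. poly (Polynomial.smult (1 / carlitz_D q x n) (P n)) t * z ^ (q ^ n)"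
  let ?B = "\<lambda>M. \<Sum>k<M. e_term q x \<sigma> (t * ?l) k"
  show "?B \<longlonglongrightarrow> e_delta q x \<sigma> (t * ?l)"
    unfolding e_delta_def
    by (intro summable_LIMSEQ summable_e_term mult_log_delta_less t z)
  have A: "?A M = (\<Sum>k<M. b_coeff q x \<sigma> k * (t * ?L (M - k)) ^ (q ^ k))" for M
  proof -
    have "?A M = (\<Sum>n<M. \<Sum>k\<le>n. b_coeff q x \<sigma> k * (t * log_term q x \<sigma> z (n - k)) ^ (q ^ k))"
      unfolding poly_basic_sequence[OF basic] sum_distrib_right
    proof (intro sum.cong refl)
      fix n k :: nat assume "k \<in> {..n}"
      then have "(z ^ (q ^ (n - k))) ^ (q ^ k) = z ^ (q ^ n)"
        by (simp flip: power_mult power_add)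
      then show "b_coeff q x \<sigma> k * beta_coeff q x \<sigma> (n - k) ^ (q ^ k) * t ^ (q ^ k) * z ^ (q ^ n) =
          b_coeff q x \<sigma> k * (t * log_term q x \<sigma> z (n - k)) ^ (q ^ k)"
        by (simp add: log_term_def power_mult_distrib mult_ac)
    qed
    also have "\<dots> = (\<Sum>k<M. \<Sum>i<M - k. b_coeff q x \<sigma> k * (t * log_term q x \<sigma> z i) ^ (q ^ k))"
      by (rule sum_triangle)
    finally show ?thesis
      by (simp add: sum_distrib_left frob_sum)
  qed
  have "av (?A M - ?B M) \<le> (c * av z) ^ (q ^ M) / c" for M
  proof -
    have "?A M - ?B M = (\<Sum>k<M. b_coeff q x \<sigma> k * (t * (?L (M - k) - ?l)) ^ (q ^ k))"
      unfolding A by (simp add: e_term_def right_diff_distrib frob_diff sum_subtractf)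
    also have "av \<dots> \<le> (c * av z) ^ (q ^ M) / c"
    proof (rule av_sum_le)
      fix k assume k: "k \<in> {..<M}"
      have "av t * av (?L (M - k) - ?l) \<le> 1 * ((c * av z) ^ (q ^ (M - k)) / c)"
        using log_delta_tail[OF z, of "M - k"] av_minus[of "?L (M - k) - ?l"] t
        by (intro mult_mono) (auto simp del: av_minus)
      then have "av (t * (?L (M - k) - ?l)) \<le> (c * av z) ^ (q ^ (M - k)) / c"
        by (simp add: av_mult)
      \<comment> \<open>The exponent is \<open>k + (M - k) = M\<close>, whatever \<open>k\<close>
        is.\<close>
      from av_b_mult_le[OF this, of k] k
      show "av (b_coeff q x \<sigma> k * (t * (?L (M - k) - ?l)) ^ (q ^ k)) \<le> (c * av z) ^ (q ^ M) / c"
        by simp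
    qed (use c_gt_1 in simp)
    finally show ?thesis .
  qed
  moreover have "(\<lambda>M. (c * av z) ^ (q ^ M)) \<longlonglongrightarrow> 0"
    using z c_gt_1 by (intro tendsto_power_power_0 less_imp_le[OF less_q_power]) auto
  then have "(\<lambda>M. (c * av z) ^ (q ^ M) / c) \<longlonglongrightarrow> 0"
    by (rule tendsto_divide_zero)
  ultimately show "(\<lambda>M. av (?A M - ?B M)) \<longlonglongrightarrow> 0"
    by (intro tendsto_sandwich[of "\<lambda>_. 0" "\<lambda>M. av (?A M - ?B M)" _ "\<lambda>M. (c * av z) ^ (q ^ M) / c"]) auto
qed

end

section \<open>The completed algebraic closure\<close>

context completed_alg_closure
begin

sublocale ultrametric_field av
  by standard (fact dist_av av_mult av_ultrametric)+

lemma iota_0: "iota 0 = 0"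
  using av_extends[of 0] by (simp add: fls_abs_def)

lemma iota_power: "iota (a ^ n) = iota a ^ n"
  by (induction n) (simp_all add: iota_one iota_mult)

lemma iota_of_nat: "iota (of_nat n) = of_nat n"
  by (induction n) (simp_all add: iota_0 iota_one iota_add)

lemma prime_CHAR_base: "Factorial_Ring.prime CHAR('k)"
  by (intro prime_CHAR_semidom finite_imp_CHAR_pos) auto

lemma CHAR_eq: "CHAR('c) = CHAR('k)"
proof -
  have "of_nat CHAR('k) = (0 :: 'c)"
    using iota_of_nat[of "CHAR('k)"] iota_0 by (metis CHAR_alg_closure of_nat_CHAR semiring_char_fls)
  then have "CHAR('c) dvd CHAR('k)"
    by (simp add: of_nat_eq_0_iff_char_dvd)
  then show ?thesis
    using prime_CHAR_base of_nat_CHAR[where ?'a = 'c] by (auto simp: prime_nat_iff)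
qed

text \<open>Roots exist on the dense image of the algebraic closure. Since
  \<open>dist u v ^ q = dist (u ^ q) (v ^ q)\<close>, roots of a convergent sequence are Cauchy, and
  their limit is the root sought.\<close>

lemma ex_frob_root:
  assumes frob: "\<And>u v :: 'c. (u - v) ^ q = u ^ q - v ^ q" and "0 < q"
  shows "\<exists>b. b ^ q = (a :: 'c)"
proof -
  have "a \<in> closure (range iota)"
    using dense_range by simp
  then obtain f where f: "\<And>n. f n \<in> range iota" "f \<longlonglongrightarrow> a"
    unfolding closure_sequential by blast
  have "\<exists>w. w ^ q = f n" for n
  proof -
    obtain r where "f n = iota r"
      using f(1)[of n] by blast
    moreover obtain s where "s ^ q = r"
      using nth_root_exists[OF \<open>0 < q\<close>] by blast
    ultimately show ?thesis
      using iota_power by metis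
  qed
  then obtain g where g: "\<And>n. g n ^ q = f n"
    by metis
  have dist_power: "dist u v ^ q = dist (u ^ q) (v ^ q)" for u v :: 'c
    by (simp add: dist_av frob flip: av_power)
  have "Cauchy g"
  proof (rule metric_CauchyI)
    fix e :: real assume "0 < e"
    then obtain N where N: "\<And>m n. m \<ge> N \<Longrightarrow> n \<ge> N \<Longrightarrow> dist (f m) (f n) < e ^ q"
      using metric_CauchyD[OF LIMSEQ_imp_Cauchy[OF f(2)], of "e ^ q"] by auto
    have "dist (g m) (g n) < e" if "m \<ge> N" "n \<ge> N" for m n
    proof (rule power_less_imp_less_base)
      show "dist (g m) (g n) ^ q < e ^ q"
        using N[OF that] by (simp only: dist_power g)
    qed (use \<open>0 < e\<close> in simp)
    then show "\<exists>N. \<forall>m\<ge>N. \<forall>n\<ge>N. dist (g m) (g n) < e"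
      by blast
  qed
  then have "convergent g"
    by (rule Cauchy_convergent)
  then obtain b where "g \<longlonglongrightarrow> b"
    unfolding convergent_def ..
  then have "(\<lambda>n. dist (g n) b ^ q) \<longlonglongrightarrow> 0 ^ q"
    by (intro tendsto_power) (simp only: tendsto_dist_iff[of g])
  then have "(\<lambda>n. dist (f n) (b ^ q)) \<longlonglongrightarrow> 0"
    using \<open>0 < q\<close> by (simp add: dist_power g zero_power)
  then have "f \<longlonglongrightarrow> b ^ q"
    by (subst tendsto_dist_iff)
  then show ?thesis
    using f(2) LIMSEQ_unique by blast
qed

lemma perfect_charI:
  assumes p: "Factorial_Ring.prime p" and q: "q = p ^ \<nu>" and card: "CARD('k) = q"
  shows "perfect_char TYPE('c) q \<nu>"
proof
  have "CHAR('k) dvd p ^ \<nu>"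
    using CHAR_dvd_CARD[where ?'a = 'k] card q by simp
  then have "CHAR('c) = p"
    using p prime_CHAR_base by (metis CHAR_eq prime_dvd_power primes_dvd_imp_eq)
  then show prime: "Factorial_Ring.prime CHAR('c)" and q': "q = CHAR('c) ^ \<nu>"
    using p q by auto
  \<comment> \<open>A field has at least two elements, which excludes
    \<open>\<nu> = 0\<close>.\<close>
  have "card {0, 1 :: 'k} \<le> CARD('k)"
    by (intro card_mono) auto
  then show "1 < q"
    using card by simp
  have "(u - v) ^ q = u ^ q - v ^ q" for u v :: 'c
    using freshmans_dream'[OF prime q', of "u - v" v] by (simp add: algebra_simps)
  then show "\<exists>b. b ^ q = a" for a :: 'c
    using \<open>1 < q\<close> by (intro ex_frob_root) auto
qed

end

text \<open>The argument \<open>t * log_delta z\<close> need not come from \<open>fls_disc\<close>,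
  so summability of \<open>e_term\<close> there is claimed separately; it makes the value of
  \<open>e_delta\<close> a genuine limit.\<close>

theorem theorem3:
  fixes iota :: "'k::{field,finite} fls alg_closure \<Rightarrow> 'c::{field,complete_space}"
    and av :: "'c \<Rightarrow> real"
    and p \<nu> q :: nat and x :: 'c and \<sigma> :: "nat \<Rightarrow> 'c" and P Q :: "nat \<Rightarrow> 'c poly"
  assumes "Factorial_Ring.prime p" and "q = p ^ \<nu>" and "CARD('k) = q"
    and "completed_alg_closure iota av"
    and "x = iota (to_ac fls_X)"
    and "av (\<sigma> 1) = 1" and "\<And>l. l \<ge> 1 \<Longrightarrow> av (\<sigma> l) \<le> 1"
    and "\<And>n. n \<ge> 1 \<Longrightarrow> S_coeff q x \<sigma> n \<noteq> 0"
    and "basic_sequence q x (delta q x \<sigma>) P"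
    and "\<And>n. Q n = Polynomial.smult (1 / carlitz_D q x n) (P n)"
  shows "(\<forall>t\<in>fls_disc. summable (e_term q x \<sigma> (iota (to_ac t))) \<and>
                       summable (log_term q x \<sigma> (iota (to_ac t)))) \<and>
         (\<forall>t\<in>fls_integers. \<forall>z\<in>fls_disc.
            summable (e_term q x \<sigma> (iota (to_ac t) * log_delta q x \<sigma> (iota (to_ac z)))) \<and>
            (\<lambda>n. poly (Q n) (iota (to_ac t)) * iota (to_ac z) ^ (q ^ n)) sums
              e_delta q x \<sigma> (iota (to_ac t) * log_delta q x \<sigma> (iota (to_ac z))))"
proof -
  interpret completed_alg_closure iota av
    by (fact assms(4))
  interpret perfect_char q \<nu> x
    by (rule perfect_charI[OF assms(1-3)])
  interpret carlitz_series av q \<nu> x \<sigma>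
  proof
    show "av x = 1 / real q"
      using av_extends[of fls_X] by (simp add: assms(3,5) fls_abs_def power_int_minus divide_simps)
  qed (fact assms(6,7))+
  have integers: "av (iota (to_ac t)) \<le> 1" if "t \<in> fls_integers" for t
    using that by (simp add: av_extends fls_integers_def)
  \<comment> \<open>The disc lies strictly inside radius \<open>1 / c\<close>. For
    \<open>q = 2\<close> one has \<open>c = q\<close>, so \<open>1 / q\<close> would only reach the
    boundary and the bound \<open>1 / 4\<close> is used; otherwise \<open>c < q\<close>, by
    comparing \<open>(q - 1)\<close>-th powers.\<close>
  have disc: "c * av (iota (to_ac z)) < 1" if "z \<in> fls_disc" for z
  proof (cases "q = 2")
    case True
    then have "av (iota (to_ac z)) \<le> 1 / 4"
      using that by (simp add: av_extends fls_disc_def assms(3))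
    moreover have "c = 2"
      unfolding c_def using True by simp
    ultimately show ?thesis
      by simp
  next
    case False
    then have "av (iota (to_ac z)) \<le> 1 / real q"
      using that by (simp add: av_extends fls_disc_def assms(3))
    moreover have "c < real q"
    proof (rule power_less_imp_less_base)
      have "c ^ (q - 1) = real q ^ 1"
        using q_gt_1 by (simp add: c_def)
      also have "\<dots> < real q ^ (q - 1)"
        using q_gt_1 False by (intro power_strict_increasing) auto
      finally show "c ^ (q - 1) < real q ^ (q - 1)" .
    qed simp
    then have "c * (1 / real q) < 1"
      using q_pos by simp
    ultimately show ?thesis
      using mult_left_mono[of "av (iota (to_ac z))" "1 / real q" c] c_gt_1 by linarith
  qed
  show ?thesis
    unfolding assms(10)
    by (intro conjI ballI summable_e_term summable_log_term basic_sequence_sums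
        mult_log_delta_less integers disc assms(9))
qed

end
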